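(* Let $L=(L(t),t\in\mathbb{T})$ be a square-integrable $H$-valued Lévy process with covariance operator $Q$, and let $((\rho_i,e_i),i\in\mathbb{N})$ be the (orthonormal) eigenpairs of $Q$. Assume that, for $n\in\mathbb{N}$, there exists a sequence of approximations $(\widetilde\ell_i^{(n)},i\in\mathbb{N})$ of one-dimensional processes $(\ell_i,i\in\mathbb{N})$ on $\mathbb{T}$ such that $$\sup_{t\in\mathbb{T}}\mathbb{E}\big(|\ell_i(t)-\widetilde\ell_i^{(n)}(t)|^2\big)\le C_\ell\,\Delta_n ,$$ where the constant $C_\ell>0$ is independent of $i$. If, for all $i\in\mathbb{N}$, the process $\sqrt{\rho_i}\,\ell_i$ is equal in distribution to $(L(\cdot),e_i)_H$, then $$\sup_{t\in\mathbb{T}}\mathbb{E}\big(\|L(t)-\widetilde L_N(t)\|_H^2\big)^{1/2}\le \Big(T\sum_{i=N+1}^\infty\rho_i\Big)^{1/2}+\Big(C_\ell\,\Delta_n\sum_{i=1}^N\rho_i\Big)^{1/2},$$ and the approximations $\widetilde L_N(t)$ converge in mean square to $L(t)$ for each $t\in\mathbb{T}$ (as $N\to\infty$ and $\Delta_n\to0$, provided that the bound $\sup_{t\in\mathbb{T}}\mathbb{E}\big(|\ell_i(t)-\widetilde\ell_i^{(n)}(t)|^2\big)\le C_\ell\,\Delta_n$ on the one-dimensional errors holds with the constant $C_\ell$ in the limit $\Delta_n\to 0$).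
   Context: $\mathbb{T}=[0,T]$ with $T>0$; $(\Omega,(\mathcal{A}_t,t\ge0),\mathbb{P})$ is a filtered probability space satisfying the usual conditions; $(H,(\cdot,\cdot)_H)$ is a separable Hilbert space. An $H$-valued Lévy process $L$ has stationary independent increments, $L(0)=0$ a.s., and is stochastically continuous. It is square-integrable if $\mathbb{E}(\|L(t)\|_H^2)<\infty$ for all $t\in\mathbb{T}$. For such $L$ there are a mean $m\in H$ and a non-negative, symmetric trace class operator $Q$ on $H$, the covariance operator of $L$, with $\mathbb{E}((L(t),h_1)_H)=t(m,h_1)_H$ and $\mathbb{E}((L(t)-mt,h_1)_H(L(s)-ms,h_2)_H)=\min(t,s)(Qh_1,h_2)_H$ for all $h_1,h_2\in H$ and $s,t\in(0,T]$. $Q$ has eigenpairs $((\rho_i,e_i),i\in\mathbb{N})$, with $(e_i)$ an orthonormal basis of $H$ and $\rho_i\ge0$. For $n\in\mathbb{N}$, $\Delta_n:=T/2^n$, and $\widetilde\ell_i^{(n)}$ denotes a piecewise constant càdlàg approximation of the one-dimensional Lévy process $\ell_i$. For $N\in\mathbb{N}$, $$L_N(t):=\sum_{i=1}^N\sqrt{\rho_i}\,e_i\,\ell_i(t),\qquad \widetilde L_N(t):=\sum_{i=1}^N\sqrt{\rho_i}\,e_i\,\widetilde\ell_i^{(n)}(t).$$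
   Formalization: The formal version additionally assumes that L_N(t) converges almost surely to L(t) for each t (equality in distribution alone does not couple the ℓ_i to L), and, for the error bound only, that the mean m of L is zero; without these the claim is false. *)

theory Defs
  imports "HOL-Probability.Probability"
begin

definition usual_conditions :: "'w measure \<Rightarrow> (real \<Rightarrow> 'w measure) \<Rightarrow> bool" where
  "usual_conditions M F \<longleftrightarrow>
     (\<forall>t\<ge>0. subalgebra M (F t)) \<and>
     (\<forall>s\<ge>0. \<forall>t\<ge>s. sets (F s) \<subseteq> sets (F t)) \<and>
     complete_measure M \<and> null_sets M \<subseteq> sets (F 0) \<and>
     (\<forall>t\<ge>0. sets (F t) = (\<Inter>s\<in>{t<..}. sets (F s)))"

definition levy_process ::
    "'w measure \<Rightarrow> real \<Rightarrow> (real \<Rightarrow> 'w \<Rightarrow> 'b::{real_normed_vector, second_countable_topology}) \<Rightarrow> bool" where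
  "levy_process M T X \<longleftrightarrow>
     (\<forall>t\<in>{0..T}. X t \<in> borel_measurable M) \<and>
     (AE \<omega> in M. X 0 \<omega> = 0) \<and>
     (\<forall>k. \<forall>\<tau>::nat \<Rightarrow> real. 0 \<le> \<tau> 0 \<and> (\<forall>j<k. \<tau> j \<le> \<tau> (Suc j)) \<and> \<tau> k \<le> T \<longrightarrow>
        prob_space.indep_vars M (\<lambda>_. borel) (\<lambda>j \<omega>. X (\<tau> (Suc j)) \<omega> - X (\<tau> j) \<omega>) {..<k}) \<and>
     (\<forall>s t h. 0 \<le> h \<and> 0 \<le> s \<and> s + h \<le> T \<and> 0 \<le> t \<and> t + h \<le> T \<longrightarrow>
        distr M borel (\<lambda>\<omega>. X (s + h) \<omega> - X s \<omega>) = distr M borel (\<lambda>\<omega>. X (t + h) \<omega> - X t \<omega>)) \<and>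
     (\<forall>t\<in>{0..T}. \<forall>\<epsilon>>0.
        ((\<lambda>s. measure M {\<omega> \<in> space M. \<epsilon> < norm (X s \<omega> - X t \<omega>)}) \<longlongrightarrow> 0) (at t within {0..T}))"

definition square_integrable_process ::
    "'w measure \<Rightarrow> real \<Rightarrow> (real \<Rightarrow> 'w \<Rightarrow> 'b::real_normed_vector) \<Rightarrow> bool" where
  "square_integrable_process M T X \<longleftrightarrow> (\<forall>t\<in>{0..T}. integrable M (\<lambda>\<omega>. (norm (X t \<omega>))\<^sup>2))"

text \<open>Trace class (nuclear) operators on a separable Hilbert space, as absolutely convergent
  series of rank-one operators.\<close>

definition trace_class :: "('h::real_inner \<Rightarrow> 'h) \<Rightarrow> bool" where
  "trace_class A \<longleftrightarrow> bounded_linear A \<and>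
     (\<exists>a b :: nat \<Rightarrow> 'h. summable (\<lambda>k. norm (a k) * norm (b k)) \<and>
        (\<forall>x. (\<lambda>k. (x \<bullet> a k) *\<^sub>R b k) sums A x))"

definition is_mean :: "'w measure \<Rightarrow> real \<Rightarrow> (real \<Rightarrow> 'w \<Rightarrow> 'h::real_inner) \<Rightarrow> 'h \<Rightarrow> bool" where
  "is_mean M T L m \<longleftrightarrow> (\<forall>t\<in>{0<..T}. \<forall>h. (\<integral>\<omega>. L t \<omega> \<bullet> h \<partial>M) = t * (m \<bullet> h))"

text \<open>The covariance is centred, so \<open>E (L(t), e\<^sub>i)\<^sup>2 = t \<rho>\<^sub>i + t\<^sup>2 (m, e\<^sub>i)\<^sup>2\<close>; a truncation error bound by
  eigenvalues of \<open>Q\<close> alone therefore needs \<open>m = 0\<close>, convergence of the truncations does not.\<close>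

definition is_covariance_operator ::
    "'w measure \<Rightarrow> real \<Rightarrow> (real \<Rightarrow> 'w \<Rightarrow> 'h::real_inner) \<Rightarrow> 'h \<Rightarrow> ('h \<Rightarrow> 'h) \<Rightarrow> bool" where
  "is_covariance_operator M T L m Q \<longleftrightarrow>
     trace_class Q \<and> (\<forall>x y. Q x \<bullet> y = x \<bullet> Q y) \<and> (\<forall>x. 0 \<le> Q x \<bullet> x) \<and>
     (\<forall>s\<in>{0<..T}. \<forall>t\<in>{0<..T}. \<forall>h1 h2.
        (\<integral>\<omega>. ((L t \<omega> - t *\<^sub>R m) \<bullet> h1) * ((L s \<omega> - s *\<^sub>R m) \<bullet> h2) \<partial>M) = min t s * (Q h1 \<bullet> h2))"

definition orthonormal_basis :: "(nat \<Rightarrow> 'h::real_inner) \<Rightarrow> bool" where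
  "orthonormal_basis e \<longleftrightarrow>
     (\<forall>i j. e i \<bullet> e j = (if i = j then 1 else 0)) \<and> closure (span (range e)) = UNIV"

definition eigenpairs :: "('h::real_inner \<Rightarrow> 'h) \<Rightarrow> (nat \<Rightarrow> real) \<Rightarrow> (nat \<Rightarrow> 'h) \<Rightarrow> bool" where
  "eigenpairs Q \<rho> e \<longleftrightarrow> orthonormal_basis e \<and> (\<forall>i. 0 \<le> \<rho> i \<and> Q (e i) = \<rho> i *\<^sub>R e i)"

text \<open>Equality of the laws on path space with the product sigma-algebra, i.e. of all
  finite-dimensional distributions.\<close>

definition equal_in_distribution ::
    "'w measure \<Rightarrow> real \<Rightarrow> (real \<Rightarrow> 'w \<Rightarrow> 'b::topological_space) \<Rightarrow> (real \<Rightarrow> 'w \<Rightarrow> 'b) \<Rightarrow> bool" where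
  "equal_in_distribution M T X Y \<longleftrightarrow>
     distr M (Pi\<^sub>M {0..T} (\<lambda>_. borel)) (\<lambda>\<omega>. \<lambda>t\<in>{0..T}. X t \<omega>) =
     distr M (Pi\<^sub>M {0..T} (\<lambda>_. borel)) (\<lambda>\<omega>. \<lambda>t\<in>{0..T}. Y t \<omega>)"

definition \<Delta> :: "real \<Rightarrow> nat \<Rightarrow> real" where
  "\<Delta> T n = T / 2 ^ n"

text \<open>Piecewise constant cadlag paths on \<open>[0,T]\<close>; a jump at the right endpoint is allowed.\<close>

definition piecewise_constant_cadlag :: "real \<Rightarrow> (real \<Rightarrow> real) \<Rightarrow> bool" where
  "piecewise_constant_cadlag T f \<longleftrightarrow>
     (\<exists>k. \<exists>s::nat \<Rightarrow> real. s 0 = 0 \<and> s k = T \<and>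
        (\<forall>j<k. s j < s (Suc j) \<and> (\<forall>t\<in>{s j..<s (Suc j)}. f t = f (s j))))"

text \<open>Indices start at 0, so the sum over \<open>i < N\<close> has the first \<open>N\<close> terms. Applied to \<open>l\<close> this
  is \<open>L\<^sub>N\<close>, applied to the approximations of \<open>l\<close> it is the approximation of \<open>L\<^sub>N\<close>.\<close>

definition truncated_series ::
    "(nat \<Rightarrow> real) \<Rightarrow> (nat \<Rightarrow> 'h::real_vector) \<Rightarrow> (nat \<Rightarrow> real \<Rightarrow> 'w \<Rightarrow> real) \<Rightarrow> nat \<Rightarrow> real \<Rightarrow> 'w \<Rightarrow> 'h" where
  "truncated_series \<rho> e l N t \<omega> = (\<Sum>i<N. (sqrt (\<rho> i) * l i t \<omega>) *\<^sub>R e i)"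

text \<open>The \<open>L\<^sub>N\<close> are truncations of an expansion of \<open>L\<close> itself: for every \<open>t\<close>, almost surely
  \<open>L(t) = (\<Sum>i. sqrt (\<rho> i) e\<^sub>i l\<^sub>i(t))\<close>. Equality in distribution of \<open>sqrt (\<rho> i) l\<^sub>i\<close> and
  \<open>(L, e\<^sub>i)\<close> alone leaves the joint law of \<open>L\<close> and the \<open>l\<^sub>i\<close> open (they could be independent),
  and then says nothing about \<open>E \<parallel>L(t) - L\<^sub>N(t)\<parallel>\<^sup>2\<close>.\<close>

definition expansion_of ::
    "'w measure \<Rightarrow> real \<Rightarrow> (nat \<Rightarrow> real) \<Rightarrow> (nat \<Rightarrow> 'h::real_normed_vector) \<Rightarrow>
     (nat \<Rightarrow> real \<Rightarrow> 'w \<Rightarrow> real) \<Rightarrow> (real \<Rightarrow> 'w \<Rightarrow> 'h) \<Rightarrow> bool" where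
  "expansion_of M T \<rho> e l L \<longleftrightarrow>
     (\<forall>t\<in>{0..T}. AE \<omega> in M. (\<lambda>N. truncated_series \<rho> e l N t \<omega>) \<longlonglongrightarrow> L t \<omega>)"

text \<open>Second moments are taken in \<open>[0,\<infinity>]\<close>, so an upper bound includes square integrability.\<close>

definition mean_square :: "'w measure \<Rightarrow> ('w \<Rightarrow> 'b::real_normed_vector) \<Rightarrow> ennreal" where
  "mean_square M X = (\<integral>\<^sup>+\<omega>. ennreal ((norm (X \<omega>))\<^sup>2) \<partial>M)"

definition ennreal_sqrt :: "ennreal \<Rightarrow> ennreal" where
  "ennreal_sqrt x = (if x = \<top> then \<top> else ennreal (sqrt (enn2real x)))"

text \<open>The bound on the one-dimensional errors at level \<open>n\<close>, uniform in \<open>i\<close>; \<open>la n i\<close> approximates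
  \<open>l i\<close>.\<close>

definition error_bound ::
    "'w measure \<Rightarrow> real \<Rightarrow> real \<Rightarrow> (nat \<Rightarrow> real \<Rightarrow> 'w \<Rightarrow> real) \<Rightarrow>
     (nat \<Rightarrow> nat \<Rightarrow> real \<Rightarrow> 'w \<Rightarrow> real) \<Rightarrow> nat \<Rightarrow> bool" where
  "error_bound M T C l la n \<longleftrightarrow>
     (\<forall>i. (SUP t\<in>{0..T}. mean_square M (\<lambda>\<omega>. l i t \<omega> - la n i t \<omega>)) \<le> ennreal (C * \<Delta> T n))"

end

theory Submission
  imports Defs
begin

text \<open>Pairing the expansion with \<open>e i\<close> gives \<open>sqrt (\<rho> i) * l i t = L t \<bullet> e i\<close> almost surely. By Parseval,
  the squared error is a sum over coordinates: those below \<open>N\<close> are one-dimensional errors weighted by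
  \<open>\<rho> i\<close>, the others contribute \<open>E (L t \<bullet> e i)\<^sup>2 = t * \<rho> i + t\<^sup>2 * (m \<bullet> e i)\<^sup>2\<close>. Summability of the latter,
  and hence of \<open>\<rho>\<close>, is again Parseval, applied to the square-integrable \<open>L t\<close>.\<close>

section \<open>Orthonormal series: norms, coefficients and truncation errors\<close>

lemma orthonormal_norm_sum_squared:
  fixes e :: "nat \<Rightarrow> 'h::real_inner"
  assumes on: "\<And>i j. e i \<bullet> e j = (if i = j then 1 else 0)"
  shows "(norm (\<Sum>i<N. a i *\<^sub>R e i))\<^sup>2 = (\<Sum>i<N. (a i)\<^sup>2)"
proof -
  have "(a i *\<^sub>R e i) \<bullet> (a j *\<^sub>R e j) = (if j = i then (a i)\<^sup>2 else 0)" for i j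
    by (simp add: on power2_eq_square)
  \<comment> \<open>The rules pulling scalars out of inner products are switched off so that the
    terms of the double sum keep the shape of the fact above, whose Kronecker delta then collapses
    it.\<close>
  then show ?thesis
    by (simp add: power2_norm_eq_inner inner_sum_left inner_sum_right del: inner_scaleR_left inner_scaleR_right)
qed

lemma orthonormal_sums_norm_squared:
  fixes e :: "nat \<Rightarrow> 'h::real_inner"
  assumes on: "\<And>i j. e i \<bullet> e j = (if i = j then 1 else 0)"
    and "(\<lambda>i. a i *\<^sub>R e i) sums x"
  shows "(\<lambda>i. (a i)\<^sup>2) sums (norm x)\<^sup>2"
  using tendsto_power[OF tendsto_norm[OF assms(2)[unfolded sums_def]], of 2]
  by (simp add: sums_def orthonormal_norm_sum_squared[OF on])

lemma orthonormal_sums_coefficient: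
  fixes e :: "nat \<Rightarrow> 'h::real_inner"
  assumes on: "\<And>i j. e i \<bullet> e j = (if i = j then 1 else 0)"
    and "(\<lambda>i. a i *\<^sub>R e i) sums x"
  shows "x \<bullet> e j = a j"
proof -
  have "(\<lambda>i. (a i *\<^sub>R e i) \<bullet> e j) sums (x \<bullet> e j)"
    using assms(2) by (rule bounded_linear.sums[OF bounded_linear_inner_left])
  moreover have "(\<lambda>i. (a i *\<^sub>R e i) \<bullet> e j) = (\<lambda>i. if i = j then a j else 0)"
    by (auto simp: on)
  ultimately show ?thesis
    using sums_single[of j "\<lambda>_. a j"] by (metis (full_types) sums_unique2)
qed

text \<open>Padding the finite sum with zero coefficients from \<open>N\<close> on turns it into an
  orthonormal series. The difference is then again such a series, and Parseval applies to its
  coefficients.\<close>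

lemma orthonormal_sums_error:
  fixes e :: "nat \<Rightarrow> 'h::real_inner"
  assumes on: "\<And>i j. e i \<bullet> e j = (if i = j then 1 else 0)"
    and "(\<lambda>i. a i *\<^sub>R e i) sums x"
  shows "(\<lambda>i. (a i - (if i < N then b i else 0))\<^sup>2) sums (norm (x - (\<Sum>i<N. b i *\<^sub>R e i)))\<^sup>2"
proof (rule orthonormal_sums_norm_squared[OF on])
  have "(\<lambda>i. (if i < N then b i *\<^sub>R e i else 0)) sums (\<Sum>i<N. b i *\<^sub>R e i)"
    using sums_If_finite_set[of "{..<N}" "\<lambda>i. b i *\<^sub>R e i"] by simp
  from sums_diff[OF assms(2) this]
  show "(\<lambda>i. (a i - (if i < N then b i else 0)) *\<^sub>R e i) sums (x - (\<Sum>i<N. b i *\<^sub>R e i))"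
    by (rule sums_cong[THEN iffD1, rotated]) (simp add: scaleR_diff_left)
qed

text \<open>Parseval holds pathwise almost surely, and nonnegativity of the terms lets sum and
  integral be exchanged. Working in \<open>[0,\<infinity>]\<close> avoids any integrability
  requirement, so the identity can also serve to establish summability.\<close>

lemma nn_integral_orthonormal_error:
  fixes e :: "nat \<Rightarrow> 'h::real_inner"
  assumes on: "\<And>i j. e i \<bullet> e j = (if i = j then 1 else 0)"
    and [measurable]: "\<And>i. a i \<in> borel_measurable M" "\<And>i. b i \<in> borel_measurable M"
    and sums: "AE \<omega> in M. (\<lambda>i. a i \<omega> *\<^sub>R e i) sums X \<omega>"
  shows "mean_square M (\<lambda>\<omega>. X \<omega> - (\<Sum>i<N. b i \<omega> *\<^sub>R e i)) =
     (\<Sum>i. mean_square M (\<lambda>\<omega>. a i \<omega> - (if i < N then b i \<omega> else 0)))"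
proof -
  have "mean_square M (\<lambda>\<omega>. X \<omega> - (\<Sum>i<N. b i \<omega> *\<^sub>R e i)) =
      (\<integral>\<^sup>+\<omega>. (\<Sum>i. ennreal ((a i \<omega> - (if i < N then b i \<omega> else 0))\<^sup>2)) \<partial>M)"
    unfolding mean_square_def
  proof (rule nn_integral_cong_AE)
    show "AE \<omega> in M. ennreal ((norm (X \<omega> - (\<Sum>i<N. b i \<omega> *\<^sub>R e i)))\<^sup>2) =
        (\<Sum>i. ennreal ((a i \<omega> - (if i < N then b i \<omega> else 0))\<^sup>2))"
      using sums
    proof eventually_elim
      case (elim \<omega>)
      note * = orthonormal_sums_error[OF on elim, where N = N and b = "\<lambda>i. b i \<omega>"]
      show ?case
        by (simp only: suminf_ennreal2[OF zero_le_power2 sums_summable[OF *]] sums_unique[OF *])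
    qed
  qed
  also have "\<dots> = (\<Sum>i. \<integral>\<^sup>+\<omega>. ennreal ((a i \<omega> - (if i < N then b i \<omega> else 0))\<^sup>2) \<partial>M)"
    by (rule nn_integral_suminf) measurable
  finally show ?thesis
    by (simp add: mean_square_def)
qed

section \<open>Second moments of a random vector and of its coordinates\<close>

lemma mean_square_eq_integral:
  assumes "integrable M (\<lambda>\<omega>. (norm (X \<omega>))\<^sup>2)"
  shows "mean_square M X = ennreal (\<integral>\<omega>. (norm (X \<omega>))\<^sup>2 \<partial>M)"
  unfolding mean_square_def using assms by (intro nn_integral_eq_integral) auto

lemma ennreal_sqrt_le:
  assumes "x \<le> ennreal a" "0 \<le> a"
  shows "ennreal_sqrt x \<le> ennreal (sqrt a)"
proof -
  have "x \<noteq> \<top>"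
    using assms by (auto simp: top_unique)
  moreover have "enn2real x \<le> a"
    using assms by (intro enn2real_leI)
  ultimately show ?thesis
    by (simp add: ennreal_sqrt_def ennreal_leI)
qed

lemma integrable_inner_squared:
  fixes X :: "'w \<Rightarrow> 'h::{real_inner, second_countable_topology}"
  assumes [measurable]: "X \<in> borel_measurable M"
    and "integrable M (\<lambda>\<omega>. (norm (X \<omega>))\<^sup>2)"
  shows "integrable M (\<lambda>\<omega>. (X \<omega> \<bullet> h)\<^sup>2)"
proof (rule Bochner_Integration.integrable_bound)
  show "integrable M (\<lambda>\<omega>. (norm (X \<omega>))\<^sup>2 * (norm h)\<^sup>2)"
    using assms(2) by simp
  show "AE \<omega> in M. norm ((X \<omega> \<bullet> h)\<^sup>2) \<le> norm ((norm (X \<omega>))\<^sup>2 * (norm h)\<^sup>2)"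
    using Cauchy_Schwarz_ineq[of _ h] by (auto simp: power2_norm_eq_inner)
qed measurable

text \<open>The covariance identity on the diagonal \<open>s = t\<close> gives the centred second
  moment. Expanding the square and inserting the mean restores the uncentred one.\<close>

lemma second_moment_inner:
  fixes L :: "real \<Rightarrow> 'w \<Rightarrow> 'h::{real_inner, second_countable_topology}"
  assumes "prob_space M" "t \<in> {0<..T}"
    and [measurable]: "L t \<in> borel_measurable M"
    and sq: "integrable M (\<lambda>\<omega>. (norm (L t \<omega>))\<^sup>2)"
    and mean: "is_mean M T L m" and cov: "is_covariance_operator M T L m Q"
  shows "(\<integral>\<omega>. (L t \<omega> \<bullet> h)\<^sup>2 \<partial>M) = t * (Q h \<bullet> h) + t\<^sup>2 * (m \<bullet> h)\<^sup>2"
proof -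
  interpret prob_space M by fact
  note i2 = integrable_inner_squared[OF assms(3) sq, of h]
  have i1: "integrable M (\<lambda>\<omega>. L t \<omega> \<bullet> h)"
    using i2 by (rule square_integrable_imp_integrable[rotated]) measurable
  have "t * (Q h \<bullet> h) = (\<integral>\<omega>. ((L t \<omega> - t *\<^sub>R m) \<bullet> h) * ((L t \<omega> - t *\<^sub>R m) \<bullet> h) \<partial>M)"
    using cov assms(2) by (simp add: is_covariance_operator_def)
  also have "\<dots> = (\<integral>\<omega>. (L t \<omega> \<bullet> h)\<^sup>2 - 2 * t * (m \<bullet> h) * (L t \<omega> \<bullet> h) + t\<^sup>2 * (m \<bullet> h)\<^sup>2 \<partial>M)"
    by (simp add: inner_diff_left power2_eq_square algebra_simps)
  also have "\<dots> = (\<integral>\<omega>. (L t \<omega> \<bullet> h)\<^sup>2 \<partial>M) - 2 * t * (m \<bullet> h) * (\<integral>\<omega>. L t \<omega> \<bullet> h \<partial>M) + t\<^sup>2 * (m \<bullet> h)\<^sup>2"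
    using i1 i2 by (simp add: prob_space)
  also have "(\<integral>\<omega>. L t \<omega> \<bullet> h \<partial>M) = t * (m \<bullet> h)"
    using mean assms(2) by (simp add: is_mean_def)
  finally show ?thesis
    by (simp add: power2_eq_square algebra_simps)
qed

text \<open>The coordinate second moments add up to the mean square of \<open>X\<close>, which is
  finite. This supplies both the vanishing tails and the summability of the eigenvalues.\<close>

lemma summable_second_moments:
  fixes e :: "nat \<Rightarrow> 'h::{real_inner, second_countable_topology}"
  assumes on: "\<And>i j. e i \<bullet> e j = (if i = j then 1 else 0)"
    and [measurable]: "X \<in> borel_measurable M"
    and sq: "integrable M (\<lambda>\<omega>. (norm (X \<omega>))\<^sup>2)"
    and sums: "AE \<omega> in M. (\<lambda>i. (X \<omega> \<bullet> e i) *\<^sub>R e i) sums X \<omega>"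
  shows "summable (\<lambda>i. \<integral>\<omega>. (X \<omega> \<bullet> e i)\<^sup>2 \<partial>M)"
proof (rule summable_suminf_not_top)
  \<comment> \<open>For \<open>N = 0\<close> the subtracted sum is empty, and the error identity
    reduces to Parseval in mean square.\<close>
  have "mean_square M X = (\<Sum>i. mean_square M (\<lambda>\<omega>. X \<omega> \<bullet> e i))"
    using nn_integral_orthonormal_error[OF on _ _ sums, where N = 0 and b = "\<lambda>_ _. 0"] by simp
  also have "\<dots> = (\<Sum>i. ennreal (\<integral>\<omega>. (X \<omega> \<bullet> e i)\<^sup>2 \<partial>M))"
    using integrable_inner_squared[OF assms(2) sq]
    by (intro suminf_cong) (simp add: mean_square_eq_integral)
  finally show "(\<Sum>i. ennreal (\<integral>\<omega>. (X \<omega> \<bullet> e i)\<^sup>2 \<partial>M)) \<noteq> \<top>"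
    unfolding mean_square_eq_integral[OF sq] by (metis ennreal_neq_top)
qed simp

section \<open>Mean square error of the truncated approximation at a fixed time\<close>

lemma error_boundD:
  assumes "error_bound M T C l la n" "t \<in> {0..T}"
  shows "mean_square M (\<lambda>\<omega>. l i t \<omega> - la n i t \<omega>) \<le> ennreal (C * \<Delta> T n)"
proof -
  have "mean_square M (\<lambda>\<omega>. l i t \<omega> - la n i t \<omega>) \<le>
      (SUP t\<in>{0..T}. mean_square M (\<lambda>\<omega>. l i t \<omega> - la n i t \<omega>))"
    using assms(2) by (rule SUP_upper)
  also have "\<dots> \<le> ennreal (C * \<Delta> T n)"
    using assms(1) by (simp add: error_bound_def)
  finally show ?thesis .
qed

text \<open>An orthonormal series determines its coefficients, so the expansion identifies
  \<open>sqrt (\<rho> i) * l i t\<close> almost surely with a coordinate of \<open>L t\<close>. The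
  form in coordinates of \<open>L\<close> gives access to second moments, the form in
  \<open>l\<close> to the one-dimensional errors.\<close>

lemma expansion_sums:
  assumes on: "\<And>i j. e i \<bullet> e j = (if i = j then 1 else 0)"
    and "expansion_of M T \<rho> e l L" "t \<in> {0..T}"
  shows "AE \<omega> in M. (\<lambda>i. (L t \<omega> \<bullet> e i) *\<^sub>R e i) sums L t \<omega>"
    and "AE \<omega> in M. (\<lambda>i. (sqrt (\<rho> i) * l i t \<omega>) *\<^sub>R e i) sums L t \<omega>"
    and "AE \<omega> in M. L t \<omega> \<bullet> e i = sqrt (\<rho> i) * l i t \<omega>"
proof -
  show *: "AE \<omega> in M. (\<lambda>i. (sqrt (\<rho> i) * l i t \<omega>) *\<^sub>R e i) sums L t \<omega>"
    using assms(2,3) by (simp add: expansion_of_def truncated_series_def sums_def)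
  show "AE \<omega> in M. L t \<omega> \<bullet> e i = sqrt (\<rho> i) * l i t \<omega>" for i
    using * by eventually_elim (rule orthonormal_sums_coefficient[OF on])
  show "AE \<omega> in M. (\<lambda>i. (L t \<omega> \<bullet> e i) *\<^sub>R e i) sums L t \<omega>"
    using * by eventually_elim (simp add: orthonormal_sums_coefficient[OF on])
qed

text \<open>The error splits over orthogonal coordinates at index \<open>N\<close>. The tail is kept
  as second moments of \<open>L t\<close> instead of eigenvalues, so that the estimate holds for
  every mean and serves both the explicit bound and the convergence claim.\<close>

lemma mean_square_truncation_le:
  fixes L :: "real \<Rightarrow> 'w \<Rightarrow> 'h::{real_inner, second_countable_topology}"
  assumes on: "\<And>i j. e i \<bullet> e j = (if i = j then 1 else 0)"
    and exp: "expansion_of M T \<rho> e l L" and t: "t \<in> {0..T}"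
    and [measurable]: "L t \<in> borel_measurable M" "\<And>i. l i t \<in> borel_measurable M"
      "\<And>i. la n i t \<in> borel_measurable M"
    and sq: "integrable M (\<lambda>\<omega>. (norm (L t \<omega>))\<^sup>2)"
    and \<rho>: "\<And>i. 0 \<le> \<rho> i" and C: "0 \<le> C * \<Delta> T n"
    and err: "error_bound M T C l la n"
  shows "mean_square M (\<lambda>\<omega>. L t \<omega> - truncated_series \<rho> e (la n) N t \<omega>) \<le>
     ennreal ((\<Sum>i. \<integral>\<omega>. (L t \<omega> \<bullet> e (i + N))\<^sup>2 \<partial>M) + C * \<Delta> T n * (\<Sum>i<N. \<rho> i))"
proof -
  define v where "v i = (\<integral>\<omega>. (L t \<omega> \<bullet> e i)\<^sup>2 \<partial>M)" for i
  \<comment> \<open>Coordinatewise majorant: the weighted one-dimensional error below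
    \<open>N\<close>, the full second moment from \<open>N\<close> on, where nothing is
    subtracted.\<close>
  define w where "w i = (if i < N then C * \<Delta> T n * \<rho> i else v i)" for i
  note sums = expansion_sums[OF on exp t]
  have v: "summable v"
    unfolding v_def by (rule summable_second_moments[OF on assms(4) sq sums(1)])
  \<comment> \<open>\<open>w\<close> agrees with the nonnegative \<open>v\<close> from index
    \<open>N\<close> on, so finitely many terms separate the two.\<close>
  have w: "summable w"
    using v by (rule summable_comparison_test_ev[rotated, OF _ ])
      (auto simp: w_def v_def eventually_sequentially intro!: exI[of _ N])
  have w_nonneg: "0 \<le> w i" for i
    using C \<rho> by (simp add: w_def v_def)
  have le: "mean_square M (\<lambda>\<omega>. sqrt (\<rho> i) * l i t \<omega> - (if i < N then sqrt (\<rho> i) * la n i t \<omega> else 0))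
      \<le> ennreal (w i)" for i
  proof (cases "i < N")
    case True
    have "mean_square M (\<lambda>\<omega>. sqrt (\<rho> i) * l i t \<omega> - sqrt (\<rho> i) * la n i t \<omega>) =
        (\<integral>\<^sup>+\<omega>. ennreal (\<rho> i) * ennreal ((norm (l i t \<omega> - la n i t \<omega>))\<^sup>2) \<partial>M)"
      unfolding mean_square_def
      by (intro nn_integral_cong)
        (simp add: \<rho> ennreal_mult[symmetric] power_mult_distrib right_diff_distrib[symmetric])
    also have "\<dots> = ennreal (\<rho> i) * mean_square M (\<lambda>\<omega>. l i t \<omega> - la n i t \<omega>)"
      unfolding mean_square_def by (rule nn_integral_cmult) measurable
    also have "\<dots> \<le> ennreal (\<rho> i) * ennreal (C * \<Delta> T n)"
      by (intro mult_left_mono error_boundD[OF err t]) simp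
    also have "\<dots> = ennreal (w i)"
      using True C \<rho> by (simp add: w_def ennreal_mult[symmetric] mult.commute)
    finally show ?thesis
      using True by simp
  next
    case False
    have "mean_square M (\<lambda>\<omega>. sqrt (\<rho> i) * l i t \<omega>) = mean_square M (\<lambda>\<omega>. L t \<omega> \<bullet> e i)"
      unfolding mean_square_def using sums(3)[of i] by (intro nn_integral_cong_AE) auto
    also have "\<dots> = ennreal (w i)"
      using False integrable_inner_squared[OF assms(4) sq, of "e i"]
      by (simp add: mean_square_eq_integral w_def v_def)
    finally show ?thesis
      using False by simp
  qed
  have "mean_square M (\<lambda>\<omega>. L t \<omega> - truncated_series \<rho> e (la n) N t \<omega>) =
     (\<Sum>i. mean_square M (\<lambda>\<omega>. sqrt (\<rho> i) * l i t \<omega> - (if i < N then sqrt (\<rho> i) * la n i t \<omega> else 0)))"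
    unfolding truncated_series_def
    by (rule nn_integral_orthonormal_error[OF on _ _ sums(2)]) measurable
  also have "\<dots> \<le> (\<Sum>i. ennreal (w i))"
    using le by (intro suminf_le) auto
  also have "\<dots> = ennreal (suminf w)"
    using w w_nonneg by (intro suminf_ennreal2)
  also have "suminf w = (\<Sum>i. w (i + N)) + sum w {..<N}"
    using w by (rule suminf_split_initial_segment)
  also have "\<dots> = (\<Sum>i. v (i + N)) + C * \<Delta> T n * (\<Sum>i<N. \<rho> i)"
    by (simp add: w_def sum_distrib_left)
  finally show ?thesis
    by (simp add: v_def)
qed

section \<open>The uniform error bound and the joint limit in \<open>N\<close> and
  \<open>n\<close>\<close>

theorem theorem2p3:
  fixes M :: "'w measure" and F :: "real \<Rightarrow> 'w measure" and T :: real
    and L :: "real \<Rightarrow> 'w \<Rightarrow> 'h::{real_inner, banach, second_countable_topology}"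
    and m :: 'h and Q :: "'h \<Rightarrow> 'h" and \<rho> :: "nat \<Rightarrow> real" and e :: "nat \<Rightarrow> 'h"
    and l :: "nat \<Rightarrow> real \<Rightarrow> 'w \<Rightarrow> real" and la :: "nat \<Rightarrow> nat \<Rightarrow> real \<Rightarrow> 'w \<Rightarrow> real"
    and C :: real
  assumes "T > 0"
    and "prob_space M" and "usual_conditions M F"
    and "levy_process M T L" and "square_integrable_process M T L"
    and "is_mean M T L m" and "is_covariance_operator M T L m Q"
    and "eigenpairs Q \<rho> e"
    and "\<And>i. levy_process M T (l i)"
    and "\<And>n i t. t \<in> {0..T} \<Longrightarrow> la n i t \<in> borel_measurable M"
    and "\<And>n i. AE \<omega> in M. piecewise_constant_cadlag T (\<lambda>t. la n i t \<omega>)"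
    and "C > 0"
    and "\<And>i. equal_in_distribution M T (\<lambda>t \<omega>. sqrt (\<rho> i) * l i t \<omega>) (\<lambda>t \<omega>. L t \<omega> \<bullet> e i)"
    and "expansion_of M T \<rho> e l L"
  shows "(\<forall>n. error_bound M T C l la n \<longrightarrow> m = 0 \<longrightarrow>
            (\<forall>N. (SUP t\<in>{0..T}. ennreal_sqrt
                    (mean_square M (\<lambda>\<omega>. L t \<omega> - truncated_series \<rho> e (la n) N t \<omega>)))
                 \<le> ennreal (sqrt (T * (\<Sum>i. \<rho> (i + N))) + sqrt (C * \<Delta> T n * (\<Sum>i<N. \<rho> i)))))
       \<and> ((\<forall>\<^sub>F n in sequentially. error_bound M T C l la n) \<longrightarrow>
            (\<forall>t\<in>{0..T}.
              ((\<lambda>(N, n). mean_square M (\<lambda>\<omega>. L t \<omega> - truncated_series \<rho> e (la n) N t \<omega>)) \<longlongrightarrow> 0)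
                (sequentially \<times>\<^sub>F sequentially)))"
proof -
  interpret prob_space M by fact
  have on: "e i \<bullet> e j = (if i = j then 1 else 0)" and \<rho>: "0 \<le> \<rho> i" and Q: "Q (e i) = \<rho> i *\<^sub>R e i" for i j
    using assms(8) unfolding eigenpairs_def orthonormal_basis_def by blast+
  have L_meas: "L t \<in> borel_measurable M" and l_meas: "l i t \<in> borel_measurable M"
    and sq: "integrable M (\<lambda>\<omega>. (norm (L t \<omega>))\<^sup>2)" if "t \<in> {0..T}" for t i
    using assms(4,5) assms(9)[of i] that
    unfolding levy_process_def square_integrable_process_def by blast+
  define v where "v t i = (\<integral>\<omega>. (L t \<omega> \<bullet> e i)\<^sup>2 \<partial>M)" for t i
  have v_summable: "summable (v t)" if "t \<in> {0..T}" for t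
    unfolding v_def
    by (rule summable_second_moments[OF on L_meas[OF that] sq[OF that]
          expansion_sums(1)[OF on assms(14) that]])
  \<comment> \<open>Mean and covariance are prescribed on \<open>{0<..T}\<close> only; at time 0 the
    formula comes from \<open>L 0 = 0\<close> almost surely.\<close>
  have v_eq: "v t i = t * \<rho> i + t\<^sup>2 * (m \<bullet> e i)\<^sup>2" if "t \<in> {0..T}" for t i
  proof (cases "t = 0")
    case True
    have "v 0 i = (\<integral>\<omega>. 0 \<partial>M)"
      unfolding v_def
    proof (rule integral_cong_AE)
      show "(\<lambda>\<omega>. (L 0 \<omega> \<bullet> e i)\<^sup>2) \<in> borel_measurable M"
        using L_meas[of 0] \<open>T > 0\<close> by simp
      show "AE \<omega> in M. (L 0 \<omega> \<bullet> e i)\<^sup>2 = 0"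
        using assms(4) unfolding levy_process_def by (elim conjE eventually_mono) simp
    qed simp
    then show ?thesis
      using True by simp
  next
    case False
    then show ?thesis
      unfolding v_def using that
      by (subst second_moment_inner[OF assms(2) _ L_meas sq assms(6,7)]) (auto simp: Q on)
  qed
  \<comment> \<open>At the positive time \<open>T\<close> the mean contributes a nonnegative term,
    hence \<open>T * \<rho> i \<le> v T i\<close>, and the right-hand side is summable.\<close>
  have \<rho>_summable: "summable \<rho>"
  proof (rule summable_comparison_test')
    show "summable (\<lambda>i. v T i / T)"
      using v_summable[of T] \<open>T > 0\<close> by (simp add: summable_divide)
    show "norm (\<rho> i) \<le> v T i / T" if "0 \<le> i" for i
      using \<open>T > 0\<close> \<rho>[of i] by (simp add: v_eq field_simps)
  qed
  have C: "0 \<le> C * \<Delta> T n" for n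
    using \<open>T > 0\<close> \<open>C > 0\<close> by (simp add: \<Delta>_def)
  have bound: "mean_square M (\<lambda>\<omega>. L t \<omega> - truncated_series \<rho> e (la n) N t \<omega>) \<le>
      ennreal ((\<Sum>i. v t (i + N)) + C * \<Delta> T n * (\<Sum>i<N. \<rho> i))"
    if "error_bound M T C l la n" "t \<in> {0..T}" for n N t
    unfolding v_def
    by (rule mean_square_truncation_le[OF on assms(14) that(2) L_meas[OF that(2)] l_meas[OF that(2)]
          assms(10)[OF that(2)] sq[OF that(2)] \<rho> C that(1)])
  show ?thesis
  proof (intro conjI allI impI ballI)
    fix n N assume err: "error_bound M T C l la n" and "m = 0"
    let ?A = "T * (\<Sum>i. \<rho> (i + N))" and ?B = "C * \<Delta> T n * (\<Sum>i<N. \<rho> i)"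
    have shift: "summable (\<lambda>i. \<rho> (i + N))"
      using \<rho>_summable by simp
    have nonneg: "0 \<le> ?A" "0 \<le> ?B"
      using \<open>T > 0\<close> C[of n] \<rho> shift by (auto intro!: mult_nonneg_nonneg suminf_nonneg sum_nonneg)
    show "(SUP t\<in>{0..T}. ennreal_sqrt
        (mean_square M (\<lambda>\<omega>. L t \<omega> - truncated_series \<rho> e (la n) N t \<omega>))) \<le> ennreal (sqrt ?A + sqrt ?B)"
    proof (rule SUP_least)
      fix t assume t: "t \<in> {0..T}"
      \<comment> \<open>With zero mean the term quadratic in \<open>t\<close> disappears, which
        leaves a tail linear in \<open>t\<close> and hence largest at \<open>T\<close>.\<close>
      have "(\<Sum>i. v t (i + N)) = t * (\<Sum>i. \<rho> (i + N))"
        using t shift by (simp add: v_eq \<open>m = 0\<close> suminf_mult)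
      also have "\<dots> \<le> ?A"
        using t shift \<rho> by (auto intro!: mult_right_mono suminf_nonneg)
      finally have "mean_square M (\<lambda>\<omega>. L t \<omega> - truncated_series \<rho> e (la n) N t \<omega>) \<le> ennreal (?A + ?B)"
        by (intro order_trans[OF bound[OF err t]] ennreal_leI) simp
      then have "ennreal_sqrt (mean_square M (\<lambda>\<omega>. L t \<omega> - truncated_series \<rho> e (la n) N t \<omega>))
          \<le> ennreal (sqrt (?A + ?B))"
        using nonneg by (intro ennreal_sqrt_le) auto
      \<comment> \<open>Orthogonality has produced the sharper bound \<open>sqrt (?A + ?B)\<close>;
        subadditivity of the square root turns it into the sum of two roots.\<close>
      also have "\<dots> \<le> ennreal (sqrt ?A + sqrt ?B)"
        using nonneg by (intro ennreal_leI sqrt_add_le_add_sqrt)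
      finally show "ennreal_sqrt (mean_square M (\<lambda>\<omega>. L t \<omega> - truncated_series \<rho> e (la n) N t \<omega>))
          \<le> ennreal (sqrt ?A + sqrt ?B)" .
    qed
  next
    fix t assume ev: "\<forall>\<^sub>F n in sequentially. error_bound M T C l la n" and t: "t \<in> {0..T}"
    let ?F = "sequentially \<times>\<^sub>F sequentially :: (nat \<times> nat) filter"
    \<comment> \<open>The majorant as a function of \<open>p = (N, n)\<close>. Its first term
      depends on \<open>N\<close> alone and is the tail of a convergent series. In the second, the
      partial sums of \<open>\<rho>\<close> converge while \<open>\<Delta> T n\<close> tends to 0,
      so \<open>N\<close> and \<open>n\<close> may grow independently of each other.\<close>
    let ?g = "\<lambda>p. (\<Sum>i. v t (i + fst p)) + C * \<Delta> T (snd p) * (\<Sum>i<fst p. \<rho> i)"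
    have "((\<lambda>p. \<Sum>i. v t (i + fst p)) \<longlongrightarrow> 0) ?F"
      by (rule filterlim_compose[OF suminf_exist_split2[OF v_summable[OF t]] filterlim_fst])
    moreover have "((\<lambda>p. C * \<Delta> T (snd p) * (\<Sum>i<fst p. \<rho> i)) \<longlongrightarrow> C * 0 * suminf \<rho>) ?F"
    proof (intro tendsto_intros)
      have "(\<lambda>n. T * (1 / 2) ^ n) \<longlonglongrightarrow> T * 0"
        by (intro tendsto_intros) simp
      then have "\<Delta> T \<longlonglongrightarrow> 0"
        by (simp add: \<Delta>_def[abs_def] power_divide)
      then show "((\<lambda>p. \<Delta> T (snd p)) \<longlongrightarrow> 0) ?F"
        by (rule filterlim_compose[OF _ filterlim_snd])
      show "((\<lambda>p. \<Sum>i<fst p. \<rho> i) \<longlongrightarrow> suminf \<rho>) ?F"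
        by (rule filterlim_compose[OF summable_LIMSEQ[OF \<rho>_summable] filterlim_fst])
    qed
    ultimately have "(?g \<longlongrightarrow> 0 + C * 0 * suminf \<rho>) ?F"
      by (rule tendsto_add)
    then have lim: "((\<lambda>p. ennreal (?g p)) \<longlongrightarrow> 0) ?F"
      using tendsto_ennrealI by fastforce
    \<comment> \<open>The second projection tends to infinity along the product filter, so a
      property of all large \<open>n\<close> holds eventually for pairs.\<close>
    have "\<forall>\<^sub>F p in ?F. error_bound M T C l la (snd p)"
      using ev filterlim_snd unfolding filterlim_iff by blast
    then have "\<forall>\<^sub>F p in ?F. (case p of (N, n) \<Rightarrow>
        mean_square M (\<lambda>\<omega>. L t \<omega> - truncated_series \<rho> e (la n) N t \<omega>)) \<le> ennreal (?g p)"
      by eventually_elim (auto simp: split_beta intro: bound[OF _ t])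
    then show "((\<lambda>(N, n). mean_square M (\<lambda>\<omega>. L t \<omega> - truncated_series \<rho> e (la n) N t \<omega>)) \<longlongrightarrow> 0) ?F"
      by (intro tendsto_sandwich[OF _ _ tendsto_const lim]) auto
  qed
qed

end
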